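(* Let $m\ge 3$, $n\geq 3$ and $2\leq l\leq n-1$. Then $\chi_{(B(m,n),\sigma_l)}(\lambda)=\gamma_m^{n-l}\chi_{B^{uv}(m,l)}(\lambda)$, where $\gamma_m=\frac{(\lambda-1)^{m-1}-(-1)^{m-1}}{\lambda}$.
   Context: The book graph $B(m,n)$ has vertices $\{u,v\}\cup\{u_j^i:1\le i\le n,1\le j\le m-2\}$ and consists of the $n$ cycles $uu_1^i\cdots u_{m-2}^ivu$ sharing the edge $uv$. For $1\le l\le n$, $\sigma_l=\{uu_1^1,\ldots,uu_1^l\}$ is the set of negative edges of the signed graph $(B(m,n),\sigma_l)$; $B^{uv}(m,l)$ denotes the signed graph on $B(m,l)$ whose only negative edge is $uv$. For a signed graph with sign function $\sigma$, a proper coloring with colors $\{-k,\ldots,0,\ldots,k\}$ is a map $c$ with $c(x)\ne\sigma(e)c(y)$ for each edge $e=xy$; the chromatic polynomial is the polynomial whose value at $\lambda=2k+1$ counts proper colorings. *)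

theory Defs
  imports Complex_Main "HOL-Library.FuncSet" "HOL-Computational_Algebra.Polynomial"
begin

section \<open>Signed graphs and proper colorings\<close>

record 'a signed_graph =
  verts :: "'a set"
  edges :: "'a set set"
  sign :: "'a set \<Rightarrow> int"

definition wf_signed_graph :: "'a signed_graph \<Rightarrow> bool" where
  "wf_signed_graph G \<longleftrightarrow>
     finite (verts G) \<and>
     (\<forall>e \<in> edges G. e \<subseteq> verts G \<and> card e = 2 \<and> sign G e \<in> {-1, 1})"

text \<open>Colorings are extensional functions, so that they are determined by their values on the
  vertices and can be counted with \<^const>\<open>card\<close>.\<close>

definition proper_colorings :: "nat \<Rightarrow> 'a signed_graph \<Rightarrow> ('a \<Rightarrow> int) set" where
  "proper_colorings k G =
     {c \<in> verts G \<rightarrow>\<^sub>E {- int k..int k}.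
        \<forall>x y. {x, y} \<in> edges G \<longrightarrow> c x \<noteq> sign G {x, y} * c y}"

definition is_chromatic_poly :: "'a signed_graph \<Rightarrow> int poly \<Rightarrow> bool" where
  "is_chromatic_poly G p \<longleftrightarrow>
     (\<forall>k::nat. poly p (2 * int k + 1) = int (card (proper_colorings k G)))"

text \<open>The description is proper for every well-formed signed graph, see
  \<open>ex1_chromatic_poly\<close> below.\<close>

definition chromatic_poly :: "'a signed_graph \<Rightarrow> int poly" where
  "chromatic_poly G = (THE p. is_chromatic_poly G p)"


section \<open>Book graphs\<close>

text \<open>\<open>Page i j\<close> is the vertex $u_j^i$.\<close>

datatype book_vertex = U | V | Page nat nat

definition book_verts :: "nat \<Rightarrow> nat \<Rightarrow> book_vertex set" where
  "book_verts m n = {U, V} \<union> {Page i j | i j. i \<in> {1..n} \<and> j \<in> {1..m - 2}}"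

definition book_edges :: "nat \<Rightarrow> nat \<Rightarrow> book_vertex set set" where
  "book_edges m n =
     {{U, V}} \<union>
     {{U, Page i 1} | i. i \<in> {1..n}} \<union>
     {{Page i j, Page i (j + 1)} | i j. i \<in> {1..n} \<and> 1 \<le> j \<and> j + 1 \<le> m - 2} \<union>
     {{Page i (m - 2), V} | i. i \<in> {1..n}}"

definition book_graph :: "nat \<Rightarrow> nat \<Rightarrow> book_vertex set set \<Rightarrow> book_vertex signed_graph" where
  "book_graph m n N =
     \<lparr>verts = book_verts m n, edges = book_edges m n, sign = (\<lambda>e. if e \<in> N then -1 else 1)\<rparr>"

definition sigma :: "nat \<Rightarrow> book_vertex set set" where
  "sigma l = {{U, Page i 1} | i. i \<in> {1..l}}"

definition book_uv :: "nat \<Rightarrow> nat \<Rightarrow> book_vertex signed_graph" where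
  "book_uv m l = book_graph m l {{U, V}}"

text \<open>The division by $\lambda$ is exact, see \<open>gamma_mult\<close>.\<close>

definition gamma :: "nat \<Rightarrow> int poly" where
  "gamma m = ([:-1, 1:] ^ (m - 1) - [:(-1) ^ (m - 1):]) div [:0, 1:]"


section \<open>Well-definedness\<close>

lemma gamma_mult: "[:0, 1:] * gamma m = [:-1, 1:] ^ (m - 1) - [:(-1) ^ (m - 1):]"
proof -
  define p :: "int poly" where "p = [:-1, 1:] ^ (m - 1) - [:(-1) ^ (m - 1):]"
  have "poly p 0 = 0"
    by (simp add: p_def)
  hence "[:0, 1:] dvd p"
    by (simp add: poly_eq_0_iff_dvd)
  thus ?thesis
    unfolding gamma_def p_def[symmetric] by (rule dvd_mult_div_cancel)
qed

lemma wf_book_graph: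
  assumes "m \<ge> 3"
  shows "wf_signed_graph (book_graph m n N)"
proof -
  have "{Page i j | i j. i \<in> {1..n} \<and> j \<in> {1..m - 2}}
      = (\<lambda>(i, j). Page i j) ` ({1..n} \<times> {1..m - 2})"
    by auto
  hence "finite (book_verts m n)"
    unfolding book_verts_def by (simp only:) simp
  thus ?thesis
    using assms unfolding wf_signed_graph_def book_graph_def book_edges_def book_verts_def
    by (auto simp: card_insert_if)
qed

lemma is_chromatic_poly_unique:
  assumes "is_chromatic_poly G p" "is_chromatic_poly G q"
  shows "p = q"
proof (rule ccontr)
  assume "p \<noteq> q"
  hence "finite {x. poly (p - q) x = 0}"
    by (intro poly_roots_finite) simp
  moreover have "range (\<lambda>k::nat. 2 * int k + 1) \<subseteq> {x. poly (p - q) x = 0}"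
    using assms unfolding is_chromatic_poly_def by auto
  moreover have "inj (\<lambda>k::nat. 2 * int k + 1)"
    by (auto intro: injI)
  ultimately show False
    using finite_imageD finite_subset infinite_UNIV_nat by blast
qed

text \<open>Existence follows by deletion and contraction, for systems of constraints of the form
  $f \neq g$ whose sides are $0$ or $\pm c(x)$. The solutions of $f = g$ are either
  all colorings, or are obtained by eliminating a vertex.\<close>

definition sterms :: "'a set \<Rightarrow> (('a \<Rightarrow> int) \<Rightarrow> int) set" where
  "sterms W = {f. f = (\<lambda>c. 0) \<or> (\<exists>x\<in>W. \<exists>s\<in>{-1, 1}. f = (\<lambda>c. s * c x))}"

definition solutions ::
    "nat \<Rightarrow> 'a set \<Rightarrow> ((('a \<Rightarrow> int) \<Rightarrow> int) \<times> (('a \<Rightarrow> int) \<Rightarrow> int)) list \<Rightarrow> ('a \<Rightarrow> int) set" where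
  "solutions k W D = {c \<in> W \<rightarrow>\<^sub>E {- int k..int k}. \<forall>(f, g) \<in> set D. f c \<noteq> g c}"

lemma sterms_cases:
  assumes "f \<in> sterms W" "g \<in> sterms W"
  shows "f = g \<or> (\<exists>x\<in>W. \<exists>h\<in>sterms (W - {x}). \<forall>c. f c = g c \<longleftrightarrow> c x = h c)"
    (is "_ \<or> ?R")
proof -
  have zero: "(\<lambda>c. 0) \<in> sterms (W - {x})" for x
    by (simp add: sterms_def)
  have witness: ?R
    if "x \<in> W" "h \<in> sterms (W - {x})" "\<forall>c. f c = g c \<longleftrightarrow> c x = h c" for x h
    using that by blast
  consider "f = (\<lambda>c. 0)" "g = (\<lambda>c. 0)"
    | y t where "f = (\<lambda>c. 0)" "y \<in> W" "t \<in> {-1, 1}" "g = (\<lambda>c. t * c y)"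
    | x s where "g = (\<lambda>c. 0)" "x \<in> W" "s \<in> {-1, 1}" "f = (\<lambda>c. s * c x)"
    | x s y t where "x \<in> W" "s \<in> {-1, 1}" "f = (\<lambda>c. s * c x)"
        "y \<in> W" "t \<in> {-1, 1}" "g = (\<lambda>c. t * c y)"
    using assms unfolding sterms_def by blast
  thus ?thesis
  proof cases
    case 1
    thus ?thesis by simp
  next
    case 2
    hence "\<forall>c. f c = g c \<longleftrightarrow> c y = (\<lambda>c. 0) c" by auto
    thus ?thesis using witness[OF \<open>y \<in> W\<close> zero] by simp
  next
    case 3
    hence "\<forall>c. f c = g c \<longleftrightarrow> c x = (\<lambda>c. 0) c" by auto
    thus ?thesis using witness[OF \<open>x \<in> W\<close> zero] by simp
  next
    case 4
    show ?thesis
    proof (cases "x = y")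
      case True
      show ?thesis
      proof (cases "s = t")
        case True
        thus ?thesis using 4 \<open>x = y\<close> by simp
      next
        case False
        hence "\<forall>c. f c = g c \<longleftrightarrow> c x = (\<lambda>c. 0) c" using 4 \<open>x = y\<close> by auto
        thus ?thesis using witness[OF \<open>x \<in> W\<close> zero] by simp
      qed
    next
      case False
      have "(\<lambda>c. (s * t) * c y) \<in> sterms (W - {x})"
        unfolding sterms_def using 4 False by auto
      moreover have "\<forall>c. f c = g c \<longleftrightarrow> c x = (\<lambda>c. (s * t) * c y) c"
        using 4 by auto
      ultimately show ?thesis using witness[OF \<open>x \<in> W\<close>] by blast
    qed
  qed
qed

lemma sterms_subst:
  assumes "f \<in> sterms W" "h \<in> sterms (W - {x})"
  shows "(\<lambda>c. f (c(x := h c))) \<in> sterms (W - {x})"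
proof -
  have neg: "(\<lambda>c. - h c) \<in> sterms (W - {x})"
    using assms(2) unfolding sterms_def by force
  consider "f = (\<lambda>c. 0)" | y s where "y \<in> W" "s \<in> {-1, 1}" "f = (\<lambda>c. s * c y)"
    using assms(1) unfolding sterms_def by blast
  thus ?thesis
  proof cases
    case 1
    thus ?thesis by (simp add: sterms_def)
  next
    case 2
    show ?thesis
    proof (cases "y = x")
      case True
      thus ?thesis using 2 neg assms(2) by auto
    next
      case False
      thus ?thesis using 2 unfolding sterms_def by auto
    qed
  qed
qed

lemma sterms_upd:
  assumes "h \<in> sterms (W - {x})"
  shows "h (c(x := a)) = h c"
  using assms unfolding sterms_def by (auto split: if_splits)

lemma sterms_range:
  assumes "h \<in> sterms W" "c \<in> W \<rightarrow>\<^sub>E {- int k..int k}"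
  shows "h c \<in> {- int k..int k}"
  using assms unfolding sterms_def by (fastforce simp: PiE_def Pi_def)

lemma finite_solutions: "finite W \<Longrightarrow> finite (solutions k W D)"
  unfolding solutions_def by (simp add: finite_PiE)

lemma solutions_contract:
  assumes "x \<in> W" "h \<in> sterms (W - {x})"
  shows "card {c \<in> solutions k W D. c x = h c} =
    card (solutions k (W - {x})
      (map (\<lambda>(f, g). (\<lambda>c. f (c(x := h c)), \<lambda>c. g (c(x := h c)))) D))"
    (is "card ?A = card ?B")
proof -
  have "bij_betw (\<lambda>c. c(x := undefined)) ?A ?B"
  proof (rule bij_betw_byWitness[where f' = "\<lambda>c. c(x := h c)"])
    show "\<forall>c\<in>?A. (c(x := undefined))(x := h (c(x := undefined))) = c"
      by (auto simp: sterms_upd[OF assms(2)])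
    show "\<forall>c\<in>?B. (c(x := h c))(x := undefined) = c"
      by (auto simp: solutions_def PiE_def extensional_def fun_eq_iff)
    show "(\<lambda>c. c(x := undefined)) ` ?A \<subseteq> ?B"
    proof (rule image_subsetI)
      fix c assume c: "c \<in> ?A"
      hence "(c(x := undefined))(x := h (c(x := undefined))) = c"
        by (auto simp: sterms_upd[OF assms(2)])
      moreover have "c(x := undefined) \<in> (W - {x}) \<rightarrow>\<^sub>E {- int k..int k}"
        using c by (auto simp: solutions_def PiE_def extensional_def)
      ultimately show "c(x := undefined) \<in> ?B"
        using c unfolding solutions_def by (auto simp: case_prod_beta)
    qed
    show "(\<lambda>c. c(x := h c)) ` ?B \<subseteq> ?A"
    proof (rule image_subsetI)
      fix c assume c: "c \<in> ?B"
      hence c': "c \<in> (W - {x}) \<rightarrow>\<^sub>E {- int k..int k}"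
        by (simp add: solutions_def)
      have "c(x := h c) \<in> W \<rightarrow>\<^sub>E {- int k..int k}"
        using c' sterms_range[OF assms(2) c'] assms(1)
        by (auto simp: PiE_def extensional_def Pi_def)
      thus "c(x := h c) \<in> ?A"
        using c unfolding solutions_def
        by (auto simp: case_prod_beta sterms_upd[OF assms(2)])
    qed
  qed
  thus ?thesis by (rule bij_betw_same_card)
qed

lemma solutions_poly:
  assumes "finite W" "\<forall>(f, g) \<in> set D. f \<in> sterms W \<and> g \<in> sterms W"
  shows "\<exists>p. \<forall>k::nat. poly p (2 * int k + 1) = int (card (solutions k W D))"
  using assms
proof (induction "length D" arbitrary: D W)
  case 0
  hence "poly ([:0, 1:] ^ card W) (2 * int k + 1) = int (card (solutions k W D))" for k
    by (simp add: solutions_def card_PiE add.commute)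
  thus ?case by blast
next
  case (Suc r)
  then obtain f g D' where D: "D = (f, g) # D'" "length D' = r"
    by (cases D) auto
  have fg: "f \<in> sterms W" "g \<in> sterms W" and D': "\<forall>(f, g) \<in> set D'. f \<in> sterms W \<and> g \<in> sterms W"
    using Suc.prems D by auto
  from sterms_cases[OF fg] show ?case
  proof (elim disjE bexE)
    assume "f = g"
    hence "solutions k W D = {}" for k
      using D by (auto simp: solutions_def)
    thus ?thesis by (intro exI[of _ 0]) simp
  next
    fix x h assume x: "x \<in> W" and h: "h \<in> sterms (W - {x})"
      and eq: "\<forall>c. f c = g c \<longleftrightarrow> c x = h c"
    define D'' where "D'' = map (\<lambda>(f, g). (\<lambda>c. f (c(x := h c)), \<lambda>c. g (c(x := h c)))) D'"
    obtain p where p: "\<And>k::nat. poly p (2 * int k + 1) = int (card (solutions k W D'))"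
      using Suc.hyps(1)[of D' W] D D' Suc.prems(1) by blast
    have "\<forall>(f, g) \<in> set D''. f \<in> sterms (W - {x}) \<and> g \<in> sterms (W - {x})"
      using D' h unfolding D''_def by (fastforce intro: sterms_subst)
    moreover have "length D'' = r"
      using D by (simp add: D''_def)
    ultimately obtain q
      where q: "\<And>k::nat. poly q (2 * int k + 1) = int (card (solutions k (W - {x}) D''))"
      using Suc.hyps(1)[of D'' "W - {x}"] Suc.prems(1) by blast
    have "poly (p - q) (2 * int k + 1) = int (card (solutions k W D))" for k
    proof -
      have "solutions k W D = solutions k W D' - {c \<in> solutions k W D'. c x = h c}"
        using D eq by (auto simp: solutions_def)
      moreover have "card {c \<in> solutions k W D'. c x = h c} \<le> card (solutions k W D')"
        by (intro card_mono finite_solutions Suc.prems) auto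
      ultimately show ?thesis
        using solutions_contract[OF x h, of k D'] finite_solutions[OF Suc.prems(1), of k D']
        by (simp add: p q D''_def card_Diff_subset of_nat_diff)
    qed
    thus ?thesis by blast
  qed
qed

lemma ex_chromatic_poly:
  assumes "wf_signed_graph G"
  shows "\<exists>p. is_chromatic_poly G p"
proof -
  have fin: "finite (verts G)" and wf: "\<And>e. e \<in> edges G \<Longrightarrow> e \<subseteq> verts G"
      "\<And>e. e \<in> edges G \<Longrightarrow> card e = 2" "\<And>e. e \<in> edges G \<Longrightarrow> sign G e \<in> {-1, 1}"
    using assms unfolding wf_signed_graph_def by auto
  have "finite (edges G)"
    using fin wf(1) by (meson Pow_iff finite_Pow_iff finite_subset subsetI)
  then obtain es where es: "set es = edges G"
    using finite_list by blast
  have "\<forall>e. \<exists>x y. e \<in> edges G \<longrightarrow> e = {x, y}"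
    using wf(2) by (metis card_2_iff)
  then obtain a b where ab: "\<And>e. e \<in> edges G \<Longrightarrow> e = {a e, b e}"
    by metis
  define D where "D = map (\<lambda>e. (\<lambda>c. (1::int) * c (a e), \<lambda>c. sign G e * c (b e))) es"
  have "\<forall>(f, g) \<in> set D. f \<in> sterms (verts G) \<and> g \<in> sterms (verts G)"
  proof -
    have "a e \<in> verts G \<and> b e \<in> verts G" if "e \<in> edges G" for e
      using ab[OF that] wf(1)[OF that] by blast
    thus ?thesis
      using wf(3) unfolding D_def sterms_def es[symmetric] by fastforce
  qed
  from solutions_poly[OF fin this] obtain p
    where p: "\<And>k::nat. poly p (2 * int k + 1) = int (card (solutions k (verts G) D))"
    by blast
  have "solutions k (verts G) D = proper_colorings k G" for k
  proof -
    have "(\<forall>(f, g) \<in> set D. f c \<noteq> g c) \<longleftrightarrow>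
        (\<forall>x y. {x, y} \<in> edges G \<longrightarrow> c x \<noteq> sign G {x, y} * c y)" for c
    proof -
      have "(\<forall>(f, g) \<in> set D. f c \<noteq> g c) \<longleftrightarrow>
          (\<forall>e \<in> edges G. c (a e) \<noteq> sign G e * c (b e))"
        by (auto simp: D_def es[symmetric])
      also have "\<dots> \<longleftrightarrow> (\<forall>x y. {x, y} \<in> edges G \<longrightarrow> c x \<noteq> sign G {x, y} * c y)"
      proof safe
        fix x y assume *: "\<forall>e \<in> edges G. c (a e) \<noteq> sign G e * c (b e)"
          and e: "{x, y} \<in> edges G" and eq: "c x = sign G {x, y} * c y"
        have "x = a {x, y} \<and> y = b {x, y} \<or> x = b {x, y} \<and> y = a {x, y}"
          using ab[OF e] by (auto simp: doubleton_eq_iff)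
        moreover have "c y = sign G {x, y} * c x"
          using eq wf(3)[OF e] by auto
        ultimately show False
          using * e eq by metis
      next
        fix e assume "\<forall>x y. {x, y} \<in> edges G \<longrightarrow> c x \<noteq> sign G {x, y} * c y"
          and "e \<in> edges G" and "c (a e) = sign G e * c (b e)"
        thus False
          using ab by metis
      qed
      finally show ?thesis .
    qed
    thus ?thesis
      by (simp add: solutions_def proper_colorings_def)
  qed
  thus ?thesis
    using p unfolding is_chromatic_poly_def by auto
qed

lemma ex1_chromatic_poly:
  assumes "wf_signed_graph G"
  shows "\<exists>!p. is_chromatic_poly G p"
  using ex_chromatic_poly[OF assms] is_chromatic_poly_unique by blast

lemma is_chromatic_poly_chromatic_poly:
  assumes "wf_signed_graph G"
  shows "is_chromatic_poly G (chromatic_poly G)"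
  unfolding chromatic_poly_def by (rule theI'[OF ex1_chromatic_poly[OF assms]])

end

theory Submission
  imports Defs
begin

text \<open>Fix the colors $a$ of $u$ and $b$ of $v$; the pages can then be colored independently.
  A page is a path from $u$ to $v$, and a negative first edge amounts to replacing $a$ by $-a$.
  An all-positive page has $\gamma_m$ colorings as soon as $a \neq b$, which the positive edge
  $uv$ enforces, so the $n - l$ positive pages contribute $\gamma_m^{n-l}$. Switching $u$, that
  is, replacing $a$ by $-a$, turns what remains into the count for $B^{uv}(m,l)$.\<close>

section \<open>Colorings of a path with prescribed end colors\<close>

text \<open>The interior vertices $1, \dots, L$ of a path are colored by $f$; the updates put the
  prescribed colors on the end vertices $0$ and $L + 1$.\<close>

definition path_colorings :: "'c set \<Rightarrow> nat \<Rightarrow> 'c \<Rightarrow> 'c \<Rightarrow> (nat \<Rightarrow> 'c) set" where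
  "path_colorings K L a b =
     {f \<in> {1..L} \<rightarrow>\<^sub>E K.
        \<forall>j\<le>L. (f(0 := a, Suc L := b)) j \<noteq> (f(0 := a, Suc L := b)) (Suc j)}"

lemma finite_path_colorings: "finite K \<Longrightarrow> finite (path_colorings K L a b)"
  unfolding path_colorings_def by (simp add: finite_PiE)

lemma path_colorings_0:
  "path_colorings K 0 a b = (if a = b then {} else {\<lambda>_. undefined})"
  by (auto simp: path_colorings_def)

text \<open>The shorter path puts its end color \<open>c\<close> at \<open>Suc L\<close>, so both
  paths carry the same colors up to there. The longer one has just one further edge, which demands
  \<open>c \<noteq> b\<close>.\<close>

lemma path_colorings_Suc_iff:
  assumes "c \<in> K" "f \<in> {1..L} \<rightarrow>\<^sub>E K"
  shows "f(Suc L := c) \<in> path_colorings K (Suc L) a b \<longleftrightarrow> c \<noteq> b \<and> f \<in> path_colorings K L a c"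
proof -
  have "f(Suc L := c) \<in> {1..Suc L} \<rightarrow>\<^sub>E K"
    using assms by (auto simp: PiE_iff extensional_def)
  thus ?thesis
    using assms unfolding path_colorings_def
    by (auto simp: le_Suc_eq all_conj_distrib imp_conjL)
qed

text \<open>Recursion on the right end: the last interior vertex of the longer path serves as the
  end vertex of the shorter one. The inverse resets it to \<open>undefined\<close> to stay
  extensional.\<close>

lemma path_colorings_Suc:
  "bij_betw (\<lambda>(c, f). f(Suc L := c)) (SIGMA c:(K - {b}). path_colorings K L a c)
     (path_colorings K (Suc L) a b)"
proof (rule bij_betw_byWitness[where f' = "\<lambda>f. (f (Suc L), f(Suc L := undefined))"])
  show "\<forall>p \<in> (SIGMA c:(K - {b}). path_colorings K L a c).
      (\<lambda>f. (f (Suc L), f(Suc L := undefined))) ((\<lambda>(c, f). f(Suc L := c)) p) = p"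
    by (auto simp: path_colorings_def PiE_def extensional_def fun_eq_iff)
  show "(\<lambda>(c, f). f(Suc L := c)) ` (SIGMA c:(K - {b}). path_colorings K L a c)
      \<subseteq> path_colorings K (Suc L) a b"
  proof (rule image_subsetI)
    fix p assume "p \<in> (SIGMA c:(K - {b}). path_colorings K L a c)"
    then obtain c f where p: "p = (c, f)" "c \<in> K" "c \<noteq> b" "f \<in> path_colorings K L a c"
      by auto
    moreover from this have "f \<in> {1..L} \<rightarrow>\<^sub>E K"
      by (simp add: path_colorings_def)
    ultimately show "(\<lambda>(c, f). f(Suc L := c)) p \<in> path_colorings K (Suc L) a b"
      by (simp add: path_colorings_Suc_iff)
  qed
  show "(\<lambda>f. (f (Suc L), f(Suc L := undefined))) ` path_colorings K (Suc L) a b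
      \<subseteq> (SIGMA c:(K - {b}). path_colorings K L a c)"
  proof (rule image_subsetI)
    fix f assume f: "f \<in> path_colorings K (Suc L) a b"
    hence "f (Suc L) \<in> K" "f(Suc L := undefined) \<in> {1..L} \<rightarrow>\<^sub>E K"
      by (auto simp: path_colorings_def PiE_iff extensional_def)
    with path_colorings_Suc_iff[of "f (Suc L)" K "f(Suc L := undefined)" L a b] f
    show "(f (Suc L), f(Suc L := undefined)) \<in> (SIGMA c:(K - {b}). path_colorings K L a c)"
      by simp
  qed
qed simp

text \<open>With \<open>q = card K\<close>, this is \<open>q\<close> times the entry at
  \<open>(a, b)\<close> of the power \<open>Suc L\<close> of the adjacency matrix of the complete
  graph on \<open>K\<close>; the bases \<open>q - 1\<close> and \<open>- 1\<close> are its
  eigenvalues. The factor \<open>q\<close> avoids a division. The induction varies \<open>b\<close>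
  because the recursion moves the right end.\<close>

lemma card_path_colorings:
  assumes "finite K" "a \<in> K" "b \<in> K"
  shows "int (card K) * int (card (path_colorings K L a b)) =
    (int (card K) - 1) ^ Suc L - (- 1) ^ Suc L + (if a = b then int (card K) * (- 1) ^ Suc L else 0)"
  using assms(3)
proof (induction L arbitrary: b)
  case 0
  thus ?case by (simp add: path_colorings_0)
next
  case (Suc L)
  let ?q = "int (card K)"
  have card: "int (card (K - {b})) = ?q - 1"
    using assms(1) Suc.prems card_gt_0_iff[of K] by (auto simp: card_Diff_singleton)
  have "card (path_colorings K (Suc L) a b) = (\<Sum>c\<in>K - {b}. card (path_colorings K L a c))"
    using bij_betw_same_card[OF path_colorings_Suc[where K = K and L = L and a = a and b = b]] assms(1)
    by (simp add: finite_path_colorings)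
  hence "?q * int (card (path_colorings K (Suc L) a b)) =
      (\<Sum>c\<in>K - {b}. ?q * int (card (path_colorings K L a c)))"
    by (simp add: sum_distrib_left)
  also have "\<dots> = (\<Sum>c\<in>K - {b}. (?q - 1) ^ Suc L - (- 1) ^ Suc L +
      (if a = c then ?q * (- 1) ^ Suc L else 0))"
    by (rule sum.cong) (use Suc.IH in auto)
  \<comment> \<open>The correction term is counted once if \<open>a\<close> lies in
    \<open>K - {b}\<close>, that is, if \<open>a \<noteq> b\<close>, and not at all
    otherwise.\<close>
  also have "\<dots> = (?q - 1) * ((?q - 1) ^ Suc L - (- 1) ^ Suc L) +
      (if a \<noteq> b then ?q * (- 1) ^ Suc L else 0)"
    using assms(1,2) by (simp only: sum.distrib sum_constant card sum.delta') auto
  also have "\<dots> = (?q - 1) ^ Suc (Suc L) - (- 1) ^ Suc (Suc L) +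
      (if a = b then ?q * (- 1) ^ Suc (Suc L) else 0)"
    by (simp add: algebra_simps)
  finally show ?case .
qed

text \<open>A path with \<open>m - 2\<close> interior vertices has \<open>m - 1\<close> edges, which
  is the exponent in \<open>gamma m\<close>. The nonzero factor \<open>2k + 1\<close>
  cancels.\<close>

lemma card_path_colorings_gamma:
  assumes "m \<ge> 2" "a \<in> {- int k..int k}" "b \<in> {- int k..int k}" "a \<noteq> b"
  shows "int (card (path_colorings {- int k..int k} (m - 2) a b)) = poly (gamma m) (2 * int k + 1)"
proof -
  let ?q = "2 * int k + 1"
  have "?q * int (card (path_colorings {- int k..int k} (m - 2) a b)) =
      (?q - 1) ^ (m - 1) - (- 1) ^ (m - 1)"
    using card_path_colorings[of "{- int k..int k}" a b "m - 2"] assms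
    by (simp add: Suc_diff_Suc numeral_2_eq_2 algebra_simps)
  also have "\<dots> = ?q * poly (gamma m) ?q"
    using arg_cong[OF gamma_mult[of m], of "\<lambda>p. poly p ?q"] by simp
  finally show ?thesis by simp
qed

section \<open>Splitting a book coloring into its pages\<close>

text \<open>The hypothesis on \<open>N\<close> keeps every page edge away from \<open>U\<close>
  positive, so a page is an ordinary path coloring once a negative edge at \<open>U\<close> is
  absorbed into the prescribed end color.\<close>

lemma proper_colorings_book_graph_iff:
  assumes "m \<ge> 3" "N \<subseteq> insert {U, V} (range (\<lambda>i. {U, Page i 1}))"
  shows "c \<in> proper_colorings k (book_graph m n N) \<longleftrightarrow>
    c \<in> book_verts m n \<rightarrow>\<^sub>E {- int k..int k} \<and>
    c U \<noteq> (if {U, V} \<in> N then - c V else c V) \<and>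
    (\<forall>i\<in>{1..n}. (\<lambda>j\<in>{1..m - 2}. c (Page i j)) \<in>
       path_colorings {- int k..int k} (m - 2) (if {U, Page i 1} \<in> N then - c U else c U) (c V))"
    (is "_ \<longleftrightarrow> ?E \<and> ?uv \<and> (\<forall>i\<in>{1..n}. ?page i)")
proof -
  let ?K = "{- int k..int k}"
  let ?s = "\<lambda>e. if e \<in> N then - 1 else 1 :: int"
  let ?first = "\<lambda>i. c (Page i 1) \<noteq> (if {U, Page i 1} \<in> N then - c U else c U)"
  let ?inner = "\<lambda>i. \<forall>j. 1 \<le> j \<and> j + 1 \<le> m - 2 \<longrightarrow> c (Page i j) \<noteq> c (Page i (j + 1))"
  let ?last = "\<lambda>i. c (Page i (m - 2)) \<noteq> c V"
  define ok where "ok e \<longleftrightarrow> (\<forall>x y. e = {x, y} \<longrightarrow> c x \<noteq> ?s e * c y)" for e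
  \<comment> \<open>The sign \<open>s\<close> is 1 or -1, so \<open>c x \<noteq> s * c y\<close>
    does not depend on the orientation of the edge.\<close>
  have ok: "ok {x, y} \<longleftrightarrow> c x \<noteq> ?s {x, y} * c y" for x y
    unfolding ok_def by (auto simp: doubleton_eq_iff)
  have pos: "{Page i j, Page i' j'} \<notin> N" "{Page i j, V} \<notin> N" for i j i' j'
    using assms(2) by (auto simp: doubleton_eq_iff)
  have ok_U: "ok {U, x} \<longleftrightarrow> c x \<noteq> (if {U, x} \<in> N then - c U else c U)" for x
    unfolding ok by auto
  have ok_UV: "ok {U, V} \<longleftrightarrow> ?uv"
    unfolding ok by auto
  have ok_inner: "ok {Page i j, Page i' j'} \<longleftrightarrow> c (Page i j) \<noteq> c (Page i' j')" for i j i' j'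
    unfolding ok using pos by auto
  have ok_last: "ok {Page i j, V} \<longleftrightarrow> c (Page i j) \<noteq> c V" for i j
    unfolding ok using pos by auto
  have "(\<forall>x y. {x, y} \<in> book_edges m n \<longrightarrow> c x \<noteq> ?s {x, y} * c y) \<longleftrightarrow> (\<forall>e\<in>book_edges m n. ok e)"
    unfolding ok_def by blast
  also have "\<dots> \<longleftrightarrow> ok {U, V} \<and> (\<forall>i\<in>{1..n}. ok {U, Page i 1} \<and>
      (\<forall>j. 1 \<le> j \<and> j + 1 \<le> m - 2 \<longrightarrow> ok {Page i j, Page i (j + 1)}) \<and> ok {Page i (m - 2), V})"
    unfolding book_edges_def ball_Un by blast
  finally have edges: "(\<forall>x y. {x, y} \<in> book_edges m n \<longrightarrow> c x \<noteq> ?s {x, y} * c y) \<longleftrightarrow>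
      ?uv \<and> (\<forall>i\<in>{1..n}. ?first i \<and> ?inner i \<and> ?last i)"
    unfolding ok_UV ok_inner ok_last unfolding ok_U .
  have page: "?page i \<longleftrightarrow> ?first i \<and> ?inner i \<and> ?last i" if ?E "i \<in> {1..n}" for i
  proof -
    \<comment> \<open>A page has an interior vertex, so the updates at \<open>0\<close> and
      \<open>Suc (m - 2)\<close> leave the colors at \<open>1\<close> and \<open>m - 2\<close>
      alone.\<close>
    obtain L where L: "m - 2 = Suc L"
      using assms(1) by (metis Suc_diff_Suc less_eq_Suc_le numeral_2_eq_2 numeral_3_eq_3)
    have "(\<lambda>j\<in>{1..m - 2}. c (Page i j)) \<in> {1..m - 2} \<rightarrow>\<^sub>E ?K"
      using that by (auto simp: book_verts_def PiE_iff)
    \<comment> \<open>Index \<open>j\<close> stands for the path edge from \<open>j\<close> to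
      \<open>Suc j\<close>: \<open>0\<close> is the edge at \<open>U\<close>, \<open>m - 2\<close>
      the edge at \<open>V\<close>.\<close>
    moreover have "(\<forall>j\<le>m - 2. P j) \<longleftrightarrow> P 0 \<and> (\<forall>j. 1 \<le> j \<and> j + 1 \<le> m - 2 \<longrightarrow> P j) \<and> P (m - 2)" for P
    proof -
      have "j \<le> m - 2 \<longleftrightarrow> j = 0 \<or> 1 \<le> j \<and> j + 1 \<le> m - 2 \<or> j = m - 2" for j
        unfolding L by auto
      thus ?thesis by metis
    qed
    ultimately show ?thesis
      unfolding path_colorings_def using L by auto
  qed
  have "c \<in> proper_colorings k (book_graph m n N) \<longleftrightarrow>
      ?E \<and> (\<forall>x y. {x, y} \<in> book_edges m n \<longrightarrow> c x \<noteq> ?s {x, y} * c y)"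
    by (simp only: proper_colorings_def book_graph_def mem_Collect_eq signed_graph.simps)
  thus ?thesis
    unfolding edges using page by blast
qed

text \<open>A proper coloring amounts to an admissible pair of colors for \<open>U\<close> and
  \<open>V\<close> together with a tuple of page colorings, so a dependent sum of function spaces is
  counted.\<close>

lemma card_proper_colorings_book_graph:
  assumes "m \<ge> 3" "N \<subseteq> insert {U, V} (range (\<lambda>i. {U, Page i 1}))"
  shows "card (proper_colorings k (book_graph m n N)) =
    (\<Sum>(a, b) \<in> {(a, b) \<in> {- int k..int k} \<times> {- int k..int k}.
        a \<noteq> (if {U, V} \<in> N then - b else b)}.
      \<Prod>i=1..n. card (path_colorings {- int k..int k} (m - 2)
        (if {U, Page i 1} \<in> N then - a else a) b))"
proof -
  let ?K = "{- int k..int k}"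
  let ?P = "\<lambda>(a, b). PiE {1..n} (\<lambda>i. path_colorings ?K (m - 2)
    (if {U, Page i 1} \<in> N then - a else a) b)"
  let ?A = "{(a, b) \<in> ?K \<times> ?K. a \<noteq> (if {U, V} \<in> N then - b else b)}"
  let ?split = "\<lambda>c. ((c U, c V), \<lambda>i\<in>{1..n}. \<lambda>j\<in>{1..m - 2}. c (Page i j))"
  \<comment> \<open>The value \<open>undefined\<close> outside the index ranges makes the glued map
    extensional on \<open>book_verts m n\<close>.\<close>
  let ?glue = "\<lambda>((a, b), F) x. case x of U \<Rightarrow> a | V \<Rightarrow> b
    | Page i j \<Rightarrow> if i \<in> {1..n} \<and> j \<in> {1..m - 2} then F i j else undefined"
  have restrict: "(\<lambda>j\<in>{1..m - 2}. f j) = f" if "f \<in> path_colorings ?K (m - 2) a b" for f a b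
    using that by (auto simp: path_colorings_def)
  have "bij_betw ?split (proper_colorings k (book_graph m n N)) (Sigma ?A ?P)"
  proof (rule bij_betw_byWitness[where f' = ?glue])
    show "\<forall>c\<in>proper_colorings k (book_graph m n N). ?glue (?split c) = c"
    proof (intro ballI ext)
      fix c x assume "c \<in> proper_colorings k (book_graph m n N)"
      hence "c \<in> extensional (book_verts m n)"
        by (simp add: proper_colorings_def book_graph_def PiE_def)
      thus "?glue (?split c) x = c x"
        by (cases x) (auto simp: book_verts_def extensional_def)
    qed
    show split_glue: "\<forall>p\<in>Sigma ?A ?P. ?split (?glue p) = p"
    proof
      fix p assume "p \<in> Sigma ?A ?P"
      then obtain a b F where p: "p = ((a, b), F)" and F: "F \<in> ?P (a, b)"
        by auto
      have "(\<lambda>i\<in>{1..n}. \<lambda>j\<in>{1..m - 2}. ?glue p (Page i j)) i = F i" for i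
      proof (cases "i \<in> {1..n}")
        case True
        with F have "F i \<in> path_colorings ?K (m - 2) (if {U, Page i 1} \<in> N then - a else a) b"
          by (auto simp: PiE_iff)
        hence "(\<lambda>j\<in>{1..m - 2}. F i j) = F i"
          by (rule restrict)
        thus ?thesis
          using True by (simp add: p cong: restrict_cong)
      next
        case False
        thus ?thesis using F by (auto simp: PiE_iff extensional_def)
      qed
      thus "?split (?glue p) = p"
        by (auto simp: p)
    qed
    show "?split ` proper_colorings k (book_graph m n N) \<subseteq> Sigma ?A ?P"
    proof (rule image_subsetI)
      fix c assume "c \<in> proper_colorings k (book_graph m n N)"
      note c = this[unfolded proper_colorings_book_graph_iff[OF assms]]
      hence "c U \<in> ?K" "c V \<in> ?K"
        by (auto simp only: book_verts_def PiE_iff)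
      with c show "?split c \<in> Sigma ?A ?P"
        by (simp add: restrict_PiE_iff)
    qed
    show "?glue ` Sigma ?A ?P \<subseteq> proper_colorings k (book_graph m n N)"
    proof (rule image_subsetI)
      fix p assume p: "p \<in> Sigma ?A ?P"
      then obtain a b F where p': "p = ((a, b), F)" and ab: "(a, b) \<in> ?A" and F: "F \<in> ?P (a, b)"
        by auto
      have "F i j \<in> ?K" if "i \<in> {1..n}" "j \<in> {1..m - 2}" for i j
        using F that unfolding path_colorings_def by (auto simp: PiE_iff)
      hence "?glue p \<in> book_verts m n \<rightarrow>\<^sub>E ?K"
        using ab by (auto simp: p' book_verts_def PiE_iff extensional_def split: book_vertex.split)
      \<comment> \<open>This is the second component of \<open>?split (?glue p) = p\<close>, read at
        page \<open>i\<close>.\<close>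
      moreover have "(\<lambda>j\<in>{1..m - 2}. ?glue p (Page i j)) = F i" if "i \<in> {1..n}" for i
      proof -
        have "?split (?glue p) = p"
          using split_glue p by (rule bspec)
        hence "snd (?split (?glue p)) i = snd p i"
          by simp
        thus ?thesis
          using that by (simp add: p')
      qed
      ultimately show "?glue p \<in> proper_colorings k (book_graph m n N)"
        unfolding proper_colorings_book_graph_iff[OF assms]
        using ab F by (auto simp: p' PiE_iff)
    qed
  qed
  hence "card (proper_colorings k (book_graph m n N)) = card (Sigma ?A ?P)"
    by (rule bij_betw_same_card)
  also have "\<dots> = (\<Sum>p\<in>?A. card (?P p))"
  proof (rule card_SigmaI)
    show "finite ?A"
      by (rule finite_subset[of _ "?K \<times> ?K"]) auto
    show "\<forall>p\<in>?A. finite (?P p)"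
      by (auto intro!: finite_PiE finite_path_colorings)
  qed
  finally show ?thesis
    by (simp add: card_PiE case_prod_beta)
qed

section \<open>Comparison of the two counts at \<open>2k + 1\<close>\<close>

theorem theorem3p9:
  fixes m n l :: nat
  assumes "m \<ge> 3" and "n \<ge> 3" and "2 \<le> l" and "l \<le> n - 1"
  shows "chromatic_poly (book_graph m n (sigma l)) =
    gamma m ^ (n - l) * chromatic_poly (book_uv m l)"
proof (rule is_chromatic_poly_unique)
  show "is_chromatic_poly (book_graph m n (sigma l)) (chromatic_poly (book_graph m n (sigma l)))"
    using wf_book_graph[OF assms(1)] by (rule is_chromatic_poly_chromatic_poly)
  show "is_chromatic_poly (book_graph m n (sigma l)) (gamma m ^ (n - l) * chromatic_poly (book_uv m l))"
    unfolding is_chromatic_poly_def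
  proof
    fix k :: nat
    let ?K = "{- int k..int k}"
    let ?w = "\<lambda>a b. int (card (path_colorings ?K (m - 2) a b))"
    let ?g = "poly (gamma m) (2 * int k + 1)"
    \<comment> \<open>The pages beyond \<open>l\<close> each contribute \<open>?g\<close> since
      \<open>a \<noteq> b\<close>. The first \<open>l\<close> keep the factor
      \<open>?w (- a) b\<close>, as \<open>- a = b\<close> remains possible.\<close>
    have pages: "(\<Prod>i=1..n. ?w (if i \<in> {1..l} then - a else a) b) = ?g ^ (n - l) * ?w (- a) b ^ l"
      if "a \<in> ?K" "b \<in> ?K" "a \<noteq> b" for a b
    proof -
      have "{1..n} = {1..l} \<union> {l + 1..n}" using assms by auto
      hence "(\<Prod>i=1..n. ?w (if i \<in> {1..l} then - a else a) b) =
          (\<Prod>i=1..l. ?w (if i \<in> {1..l} then - a else a) b) * (\<Prod>i=l + 1..n. ?w (if i \<in> {1..l} then - a else a) b)"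
        by (simp add: prod.union_disjoint)
      also have "\<dots> = ?w (- a) b ^ l * ?w a b ^ (n - l)" by simp
      finally show ?thesis
        using card_path_colorings_gamma[of m a k b] that assms(1) by simp
    qed
    have "int (card (proper_colorings k (book_graph m n (sigma l)))) =
        (\<Sum>(a, b) \<in> {(a, b) \<in> ?K \<times> ?K. a \<noteq> b}. \<Prod>i=1..n. ?w (if i \<in> {1..l} then - a else a) b)"
    proof -
      have "sigma l \<subseteq> insert {U, V} (range (\<lambda>i. {U, Page i 1}))" "{U, V} \<notin> sigma l"
        "{U, Page i 1} \<in> sigma l \<longleftrightarrow> i \<in> {1..l}" for i
        by (auto simp: sigma_def doubleton_eq_iff)
      thus ?thesis
        using card_proper_colorings_book_graph[OF assms(1), of "sigma l" k n]
        by (simp add: case_prod_beta cong: prod.cong if_cong)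
    qed
    also have "\<dots> = (\<Sum>(a, b) \<in> {(a, b) \<in> ?K \<times> ?K. a \<noteq> b}. ?g ^ (n - l) * ?w (- a) b ^ l)"
      by (rule sum.cong) (use pages in auto)
    also have "\<dots> = ?g ^ (n - l) * (\<Sum>(a, b) \<in> {(a, b) \<in> ?K \<times> ?K. a \<noteq> b}. ?w (- a) b ^ l)"
      by (simp add: sum_distrib_left case_prod_beta)
    \<comment> \<open>Negating \<open>a\<close> is an involution of the symmetric color set
      \<open>?K\<close>. It makes the first \<open>l\<close> pages positive and turns
      \<open>a \<noteq> b\<close> into the condition of a negative edge \<open>uv\<close>.\<close>
    also have "(\<Sum>(a, b) \<in> {(a, b) \<in> ?K \<times> ?K. a \<noteq> b}. ?w (- a) b ^ l) =
        (\<Sum>(a, b) \<in> {(a, b) \<in> ?K \<times> ?K. a \<noteq> - b}. ?w a b ^ l)"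
      by (rule sum.reindex_bij_witness[of _ "\<lambda>(a, b). (- a, b)" "\<lambda>(a, b). (- a, b)"]) auto
    also have "\<dots> = int (card (proper_colorings k (book_uv m l)))"
    proof -
      have "{{U, V}} \<subseteq> insert {U, V} (range (\<lambda>i. {U, Page i 1}))" "{U, Page i 1} \<notin> {{U, V}}" for i
        by (auto simp: doubleton_eq_iff)
      thus ?thesis
        using card_proper_colorings_book_graph[OF assms(1), of "{{U, V}}" k l]
        by (simp add: book_uv_def case_prod_beta)
    qed
    also have "\<dots> = poly (chromatic_poly (book_uv m l)) (2 * int k + 1)"
      using is_chromatic_poly_chromatic_poly[OF wf_book_graph[OF assms(1)], of l "{{U, V}}"]
      by (simp add: is_chromatic_poly_def book_uv_def)
    finally show "poly (gamma m ^ (n - l) * chromatic_poly (book_uv m l)) (2 * int k + 1) =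
        int (card (proper_colorings k (book_graph m n (sigma l))))"
      by simp
  qed
qed

end
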